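(* Suppose that for each $i\in I$ there are $\theta_i\in(0,1]$ and $H_i>0$ with $\|\nabla f_i(x)-\nabla f_i(y)\|\le H_i\|y-x\|^{\theta_i}$ for all $x,y\in\Omega$, and that there exists $f_i^*\in\mathbb{R}$ such that $f_i(x)\ge f_i^*$ for all $x\in\Omega$. Let $\theta_{\min}=\min_{i\in I}\theta_i$, and let $\{x_k\}_{k\ge0}$ be generated by the Metropolis-Based Nonmonotone Line Search Method with $\gamma>0$ and $\tau_k=1/\ln(k+1)$ (with the convention $1/\tau_0=\ln 1=0$). Then the method takes no more than $\mathcal{O}\left(\epsilon^{-\left(1+\frac1{\theta_{\min}}\right)\left(1+\frac1\gamma\right)}\right)$ iterations to find an $\epsilon$-approximate Pareto critical point; that is, there is a constant $C>0$, depending only on $c_1,c_2,\beta,\rho,\gamma$ and on $\sigma_i$, $\theta_i$, $H_i$, $f_i(x_0)-f_i^*$ ($i\in I$), such that for every $\epsilon\in(0,1)$ and every $T$ with $\|s(x_k)\|>\epsilon$ for $k=0,\ldots,T-1$ one has $$T\le C\,\epsilon^{-\left(1+\frac1{\theta_{\min}}\right)\left(1+\frac1\gamma\right)}.$$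
   Context: Setting: $\emptyset\ne\Omega\subset\mathbb{R}^n$ is closed and convex, $F=(f_1,\ldots,f_m)^T:\mathbb{R}^n\to\mathbb{R}^m$ is continuously differentiable (possibly nonconvex), $I=\{1,\ldots,m\}$, $\|\cdot\|$ is the Euclidean norm, $\mathbb{R}^m_+=\{z\in\mathbb{R}^m: z_i\ge0,\ i\in I\}$. For $x\in\Omega$, $\Omega-x=\{y\in\mathbb{R}^n: y+x\in\Omega\}$, and $s(x)$ is the unique minimizer over $d\in\Omega-x$ of $\max_{i\in I}\{\nabla f_i(x)^Td\}+\frac12\|d\|^2$. A point $x\in\Omega$ is an $\epsilon$-approximate Pareto critical point when $\|s(x)\|\le\epsilon$. Metropolis-Based Nonmonotone Line Search Method. Parameters: $x_0\in\Omega$, $\beta,\rho\in(0,1)$, $c_1,c_2>0$, $\sigma\in\mathbb{R}^m_+$, $\gamma>0$, and a sequence $\{\tau_k\}_{k\ge0}$ of positive numbers with $\tau_k\to0$. At each iteration $k=0,1,2,\ldots$: (Step 1) choose $d(x_k)\in\Omega-x_k$ with $\max_{i\in I}\{\nabla f_i(x_k)^Td(x_k)\}\le-c_1\|s(x_k)\|^2$ and $\|d(x_k)\|\le c_2\|s(x_k)\|$. (Step 2) For $\ell=0,1,2,\ldots$ put $x_{k,\ell}^+=x_k+\beta^\ell d(x_k)$ and $$[\nu_{k,\ell}]_i=\sigma_i\exp\left(-\frac{\max\{\gamma,\ f_i(x_{k,\ell}^+)-f_i(x_k)\}}{\tau_k}\right),\quad i\in I,$$ and let $\ell_k$ be the first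 $\ell$ such that $f_i(x_{k,\ell}^+)\le f_i(x_k)+\rho\beta^\ell\nabla f_i(x_k)^Td(x_k)+[\nu_{k,\ell}]_i$ for all $i\in I$. (Step 3) Set $\nu_k=\nu_{k,\ell_k}$, $\alpha_k=\beta^{\ell_k}$, $x_{k+1}=x_{k,\ell_k}^+$. *)

theory Defs
  imports "HOL-Analysis.Analysis"
begin

text \<open>
  The complexity constant is to be independent of the ambient dimension \<open>n\<close>, so \<open>n\<close> has to be
  quantified inside the statement and cannot be a type (as in \<open>real ^ 'n\<close>). All the spaces
  \<open>\<real>\<^sup>n\<close> are therefore taken as subspaces of one inner product space, the finitely
  supported real sequences with the Euclidean inner product: \<open>Rn n\<close> below consists of the
  sequences vanishing from index \<open>n\<close> on, and norm, convexity, closedness, continuity and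
  derivatives are those of the library.
\<close>

typedef finseq = "{x :: nat \<Rightarrow> real. finite {i. x i \<noteq> 0}}"
  morphisms coord Abs_finseq
  by (rule exI[of _ "\<lambda>_. 0"]) simp

setup_lifting type_definition_finseq

lemma finite_support: "finite {i. coord x i \<noteq> 0}"
  using coord by blast

lemma finseq_eqI: "(\<And>i. coord x i = coord y i) \<Longrightarrow> x = y"
  by (simp add: coord_inject[symmetric] ext)

instantiation finseq :: real_vector
begin

lift_definition zero_finseq :: finseq is "\<lambda>_. 0" by simp

lift_definition plus_finseq :: "finseq \<Rightarrow> finseq \<Rightarrow> finseq" is "\<lambda>x y i. x i + y i"
proof -
  fix x y :: "nat \<Rightarrow> real"
  assume "finite {i. x i \<noteq> 0}" "finite {i. y i \<noteq> 0}"
  moreover have "{i. x i + y i \<noteq> 0} \<subseteq> {i. x i \<noteq> 0} \<union> {i. y i \<noteq> 0}" by auto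
  ultimately show "finite {i. x i + y i \<noteq> 0}" by (meson finite_UnI finite_subset)
qed

lift_definition minus_finseq :: "finseq \<Rightarrow> finseq \<Rightarrow> finseq" is "\<lambda>x y i. x i - y i"
proof -
  fix x y :: "nat \<Rightarrow> real"
  assume "finite {i. x i \<noteq> 0}" "finite {i. y i \<noteq> 0}"
  moreover have "{i. x i - y i \<noteq> 0} \<subseteq> {i. x i \<noteq> 0} \<union> {i. y i \<noteq> 0}" by auto
  ultimately show "finite {i. x i - y i \<noteq> 0}" by (meson finite_UnI finite_subset)
qed

lift_definition uminus_finseq :: "finseq \<Rightarrow> finseq" is "\<lambda>x i. - x i" by simp

lift_definition scaleR_finseq :: "real \<Rightarrow> finseq \<Rightarrow> finseq" is "\<lambda>r x i. r * x i"
  by (rule finite_subset[rotated]) auto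

instance
  apply standard
  subgoal by (transfer; simp add: add.assoc)
  subgoal by (transfer; simp add: add.commute)
  subgoal by (transfer; simp)
  subgoal by (transfer; simp)
  subgoal by (transfer; simp)
  subgoal by (transfer; simp add: distrib_left)
  subgoal by (transfer; simp add: distrib_right)
  subgoal by (transfer; simp add: mult.assoc)
  subgoal by (transfer; simp)
  done

end

instantiation finseq :: real_inner
begin

definition inner_finseq :: "finseq \<Rightarrow> finseq \<Rightarrow> real" where
  "inner_finseq x y = (\<Sum>i | coord x i \<noteq> 0. coord x i * coord y i)"

definition norm_finseq :: "finseq \<Rightarrow> real" where
  "norm_finseq x = sqrt (inner x x)"

definition sgn_finseq :: "finseq \<Rightarrow> finseq" where
  "sgn_finseq x = x /\<^sub>R norm x"

definition dist_finseq :: "finseq \<Rightarrow> finseq \<Rightarrow> real" where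
  "dist_finseq x y = norm (x - y)"

definition uniformity_finseq :: "(finseq \<times> finseq) filter" where
  "uniformity_finseq = (INF e\<in>{0<..}. principal {(x, y). dist x y < e})"

definition open_finseq :: "finseq set \<Rightarrow> bool" where
  "open_finseq U \<longleftrightarrow> (\<forall>x\<in>U. \<forall>\<^sub>F (x', y) in uniformity. x' = x \<longrightarrow> y \<in> U)"

lemma inner_finseq_superset:
  assumes "finite S" "{i. coord x i \<noteq> 0} \<subseteq> S"
  shows "inner x y = (\<Sum>i\<in>S. coord x i * coord y i)"
  unfolding inner_finseq_def using assms by (intro sum.mono_neutral_left) auto

instance
proof
  fix x y z :: finseq and r :: real
  define S where "S = {i. coord x i \<noteq> 0} \<union> {i. coord y i \<noteq> 0} \<union> {i. coord (x + y) i \<noteq> 0}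
    \<union> {i. coord (r *\<^sub>R x) i \<noteq> 0}"
  have S: "finite S" by (simp add: S_def finite_support)
  have sub: "{i. coord x i \<noteq> 0} \<subseteq> S" "{i. coord y i \<noteq> 0} \<subseteq> S" "{i. coord (x + y) i \<noteq> 0} \<subseteq> S"
    "{i. coord (r *\<^sub>R x) i \<noteq> 0} \<subseteq> S"
    by (auto simp: S_def)
  note ip = sub[THEN inner_finseq_superset[OF S]]
  show "inner x y = inner y x" by (simp add: ip mult.commute)
  show "inner (x + y) z = inner x z + inner y z"
    by (simp add: ip plus_finseq.rep_eq algebra_simps sum.distrib)
  show "inner (r *\<^sub>R x) y = r * inner x y"
    by (simp add: ip scaleR_finseq.rep_eq sum_distrib_left mult.assoc)
  show "0 \<le> inner x x" by (simp add: inner_finseq_def sum_nonneg)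
  show "(inner x x = 0) = (x = 0)"
  proof
    assume "inner x x = 0"
    then have "\<forall>i\<in>{i. coord x i \<noteq> 0}. coord x i * coord x i = 0"
      unfolding inner_finseq_def by (subst (asm) sum_nonneg_eq_0_iff) (auto simp: finite_support)
    then show "x = 0" by (intro finseq_eqI) (auto simp: zero_finseq.rep_eq)
  qed (simp add: inner_finseq_def zero_finseq.rep_eq)
qed (simp_all add: norm_finseq_def sgn_finseq_def dist_finseq_def uniformity_finseq_def
    open_finseq_def)

end

definition Rn :: "nat \<Rightarrow> finseq set" where
  "Rn n = {x. \<forall>i\<ge>n. coord x i = 0}"

lemma inner_Rn: "x \<in> Rn n \<Longrightarrow> inner x y = (\<Sum>i<n. coord x i * coord y i)"
  by (rule inner_finseq_superset) (auto simp: Rn_def not_le[symmetric])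

lemma subspace_Rn: "subspace (Rn n)"
  by (auto simp: subspace_def Rn_def zero_finseq.rep_eq plus_finseq.rep_eq scaleR_finseq.rep_eq)

lemma Rn_unique_vector: "\<exists>!x. x \<in> Rn n \<and> (\<forall>i<n. coord x i = v i)"
proof (rule ex_ex1I)
  have "finite {i. (if i < n then v i else 0) \<noteq> 0}"
    by (rule finite_subset[of _ "{..<n}"]) auto
  then have "coord (Abs_finseq (\<lambda>i. if i < n then v i else 0)) = (\<lambda>i. if i < n then v i else 0)"
    by (simp add: Abs_finseq_inverse)
  then show "\<exists>x. x \<in> Rn n \<and> (\<forall>i<n. coord x i = v i)"
    by (intro exI[of _ "Abs_finseq (\<lambda>i. if i < n then v i else 0)"]) (simp add: Rn_def)
next
  fix x y
  assume xy: "x \<in> Rn n \<and> (\<forall>i<n. coord x i = v i)" "y \<in> Rn n \<and> (\<forall>i<n. coord y i = v i)"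
  show "x = y"
  proof (rule finseq_eqI)
    fix i show "coord x i = coord y i"
      using xy by (cases "i < n") (simp_all add: Rn_def)
  qed
qed

definition cont_diff_with_gradient :: "nat \<Rightarrow> (finseq \<Rightarrow> real) \<Rightarrow> (finseq \<Rightarrow> finseq) \<Rightarrow> bool" where
  "cont_diff_with_gradient n f g \<longleftrightarrow>
     (\<forall>x\<in>Rn n. g x \<in> Rn n \<and> (f has_derivative (\<lambda>h. g x \<bullet> h)) (at x within Rn n)) \<and>
     continuous_on (Rn n) g"

text \<open>
  In the following, component functions \<open>f i\<close> and gradients \<open>g i\<close> are indexed by
  \<open>i \<in> {1..m}\<close>, with \<open>g i x\<close> playing the role of \<open>\<nabla>f\<^sub>i(x)\<close>.
\<close>

definition max_slope :: "nat \<Rightarrow> (nat \<Rightarrow> finseq \<Rightarrow> finseq) \<Rightarrow> finseq \<Rightarrow> finseq \<Rightarrow> real" where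
  "max_slope m g x d = Max ((\<lambda>i. g i x \<bullet> d) ` {1..m})"

definition translate_to :: "finseq set \<Rightarrow> finseq \<Rightarrow> finseq set" where
  "translate_to \<Omega> x = {y. y + x \<in> \<Omega>}"

definition steepest_dir :: "nat \<Rightarrow> (nat \<Rightarrow> finseq \<Rightarrow> finseq) \<Rightarrow> finseq set \<Rightarrow> finseq \<Rightarrow> finseq" where
  "steepest_dir m g \<Omega> x =
     (THE d. is_arg_min (\<lambda>d. max_slope m g x d + (norm d)\<^sup>2 / 2) (\<lambda>d. d \<in> translate_to \<Omega> x) d)"

definition metropolis_term ::
  "(nat \<Rightarrow> finseq \<Rightarrow> real) \<Rightarrow> (nat \<Rightarrow> real) \<Rightarrow> real \<Rightarrow> real \<Rightarrow> finseq \<Rightarrow> finseq \<Rightarrow> nat \<Rightarrow> real" where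
  "metropolis_term f \<sigma> \<gamma> t x y i = \<sigma> i * exp (- (max \<gamma> (f i y - f i x) / t))"

definition accepted ::
  "nat \<Rightarrow> (nat \<Rightarrow> finseq \<Rightarrow> real) \<Rightarrow> (nat \<Rightarrow> finseq \<Rightarrow> finseq) \<Rightarrow> real \<Rightarrow> real \<Rightarrow> (nat \<Rightarrow> real) \<Rightarrow> real
    \<Rightarrow> real \<Rightarrow> finseq \<Rightarrow> finseq \<Rightarrow> nat \<Rightarrow> bool" where
  "accepted m f g \<beta> \<rho> \<sigma> \<gamma> t x d l \<longleftrightarrow>
     (\<forall>i\<in>{1..m}. f i (x + \<beta> ^ l *\<^sub>R d) \<le>
        f i x + \<rho> * \<beta> ^ l * (g i x \<bullet> d) + metropolis_term f \<sigma> \<gamma> t x (x + \<beta> ^ l *\<^sub>R d) i)"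

text \<open>
  \<open>x k\<close>, \<open>d k\<close>, \<open>ls k\<close> and \<open>\<tau> k\<close> are the iterate, the search direction, the accepted number of
  backtracking steps and the temperature of iteration \<open>k\<close>.
\<close>

definition metropolis_method ::
  "nat \<Rightarrow> (nat \<Rightarrow> finseq \<Rightarrow> real) \<Rightarrow> (nat \<Rightarrow> finseq \<Rightarrow> finseq) \<Rightarrow> finseq set \<Rightarrow> real \<Rightarrow> real \<Rightarrow> real \<Rightarrow> real
    \<Rightarrow> (nat \<Rightarrow> real) \<Rightarrow> real \<Rightarrow> (nat \<Rightarrow> real) \<Rightarrow> (nat \<Rightarrow> finseq) \<Rightarrow> (nat \<Rightarrow> finseq) \<Rightarrow> (nat \<Rightarrow> nat) \<Rightarrow> bool"
where
  "metropolis_method m f g \<Omega> c1 c2 \<beta> \<rho> \<sigma> \<gamma> \<tau> x d ls \<longleftrightarrow>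
     x 0 \<in> \<Omega> \<and>
     (\<forall>k. d k \<in> translate_to \<Omega> (x k) \<and>
          max_slope m g (x k) (d k) \<le> - c1 * (norm (steepest_dir m g \<Omega> (x k)))\<^sup>2 \<and>
          norm (d k) \<le> c2 * norm (steepest_dir m g \<Omega> (x k)) \<and>
          accepted m f g \<beta> \<rho> \<sigma> \<gamma> (\<tau> k) (x k) (d k) (ls k) \<and>
          (\<forall>l<ls k. \<not> accepted m f g \<beta> \<rho> \<sigma> \<gamma> (\<tau> k) (x k) (d k) l) \<and>
          x (Suc k) = x k + \<beta> ^ ls k *\<^sub>R d k)"

text \<open>
  For \<open>k = 0\<close> the value is \<open>1 / ln 1 = 1 / 0 = 0\<close>, and division by it yields \<open>0\<close> again, so that
  the exponential in \<^const>\<open>metropolis_term\<close> equals 1: precisely the convention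
  \<open>1 / \<tau>\<^sub>0 = ln 1 = 0\<close>. For \<open>k \<ge> 1\<close> the temperatures are positive.
\<close>

definition log_temperature :: "nat \<Rightarrow> real" where
  "log_temperature k = 1 / ln (real k + 1)"

end

(* Telescoping the acceptance test for one objective bounds T times the guaranteed decrease
   a = kappa * eps^p, p = 1 + 1/theta_min, by the initial gap plus the sum of the Metropolis
   allowances sigma * (k+1)^(-gamma). An allowance exceeds a/2 only for the first
   (2 sigma/a)^(1/gamma) iterations, so at least half of the decrease survives, up to a constant
   multiple of a^(-1/gamma); dividing by a gives the exponent p * (1 + 1/gamma). *)

theory Submission
  imports Defs
begin

section \<open>Hoelder gradients and the length of rejected steps\<close>

lemma convex_add_scaleR_mem:
  fixes x d :: "'a::real_vector"
  assumes "convex S" "x \<in> S" "x + d \<in> S" "0 \<le> t" "t \<le> 1"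
  shows "x + t *\<^sub>R d \<in> S"
proof -
  have "(1 - t) *\<^sub>R x + t *\<^sub>R (x + d) \<in> S"
    using assms by (intro convexD) auto
  then show ?thesis by (simp add: algebra_simps)
qed

text \<open>The mean value theorem on the segment replaces the increment by the slope at an
  intermediate point; Cauchy-Schwarz and the Hoelder bound compare that slope with the one at
  \<open>x\<close>. Convexity keeps the segment in \<open>S\<close>, so derivatives relative to
  \<open>S\<close> suffice. The mean value argument gives the constant \<open>H\<close> instead of
  the \<open>H / (1 + \<theta>)\<close> of an integral remainder.\<close>

lemma holder_gradient_upper_bound:
  fixes f :: "'a::real_inner \<Rightarrow> real" and g :: "'a \<Rightarrow> 'a"
  assumes S: "convex S" "x \<in> S" "x + d \<in> S"
    and deriv: "\<And>y. y \<in> S \<Longrightarrow> (f has_derivative (\<lambda>h. g y \<bullet> h)) (at y within S)"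
    and holder: "\<And>y z. y \<in> S \<Longrightarrow> z \<in> S \<Longrightarrow> norm (g y - g z) \<le> H * norm (z - y) powr \<theta>"
    and "0 \<le> H" "0 < \<theta>" "0 < a" "a \<le> 1"
  shows "f (x + a *\<^sub>R d) \<le> f x + a * (g x \<bullet> d) + H * a powr (1 + \<theta>) * norm d powr (1 + \<theta>)"
proof -
  have mem: "x + t *\<^sub>R d \<in> S" if "0 \<le> t" "t \<le> a" for t
    using convex_add_scaleR_mem[OF S, of t] that \<open>a \<le> 1\<close> by simp
  have der: "((\<lambda>t. f (x + t *\<^sub>R d)) has_derivative (\<lambda>t. g (x + t0 *\<^sub>R d) \<bullet> (t *\<^sub>R d)))
      (at t0 within {0..a})" if "0 \<le> t0" "t0 \<le> a" for t0
  proof (rule has_derivative_in_compose2[where t = S and g = f and f = "\<lambda>t. x + t *\<^sub>R d"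
        and g' = "\<lambda>y h. g y \<bullet> h"])
    show "((\<lambda>t. x + t *\<^sub>R d) has_derivative (\<lambda>t. t *\<^sub>R d)) (at t0 within {0..a})"
      by (auto intro!: derivative_eq_intros)
  qed (use deriv mem that in auto)
  obtain t where t: "t \<in> {0<..<a}"
    and eq: "f (x + a *\<^sub>R d) - f (x + 0 *\<^sub>R d) = g (x + t *\<^sub>R d) \<bullet> ((a - 0) *\<^sub>R d)"
    using mvt_simple[OF \<open>0 < a\<close>, of "\<lambda>t. f (x + t *\<^sub>R d)" "\<lambda>t0 t. g (x + t0 *\<^sub>R d) \<bullet> (t *\<^sub>R d)"] der
    by auto
  have "(g (x + t *\<^sub>R d) - g x) \<bullet> d \<le> norm (g (x + t *\<^sub>R d) - g x) * norm d"
    by (rule norm_cauchy_schwarz)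
  also have "\<dots> \<le> (H * norm (t *\<^sub>R d) powr \<theta>) * norm d"
    using holder[of "x + t *\<^sub>R d" x] mem[of t] t S(2) by (intro mult_right_mono) auto
  also have "\<dots> = H * t powr \<theta> * norm d powr (1 + \<theta>)"
    using t by (cases "d = 0") (simp_all add: powr_mult powr_add)
  also have "\<dots> \<le> H * a powr \<theta> * norm d powr (1 + \<theta>)"
    using t \<open>0 \<le> H\<close> \<open>0 < \<theta>\<close> by (intro mult_right_mono mult_left_mono powr_mono2) auto
  finally have "a * ((g (x + t *\<^sub>R d) - g x) \<bullet> d) \<le> a * (H * a powr \<theta> * norm d powr (1 + \<theta>))"
    using \<open>0 < a\<close> by (intro mult_left_mono) auto
  then show ?thesis
    using eq \<open>0 < a\<close> by (simp add: powr_add inner_diff_left algebra_simps)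
qed

text \<open>If \<open>a\<close> fails the test with a nonnegative allowance \<open>\<nu>\<close>, the step is already long.\<close>
lemma rejected_step_lower_bound:
  fixes a s :: real
  assumes upper: "fa \<le> f0 + a * q + H * a powr (1 + \<theta>) * D powr (1 + \<theta>)"
    and reject: "f0 + \<rho> * a * q + \<nu> < fa" and "0 \<le> \<nu>"
    and q: "q \<le> - c1 * s\<^sup>2" and D: "0 \<le> D" "D \<le> c2 * s"
    and pos: "0 < a" "0 < s" "0 < H" "0 < \<theta>" "0 < c1" "0 < c2" "\<rho> < 1"
  shows "((1 - \<rho>) * c1 / (H * c2 powr (1 + \<theta>))) powr (1 / \<theta>) * s powr (1 + 1 / \<theta>) \<le> a * s\<^sup>2"
proof -
  define B where "B = H * c2 powr (1 + \<theta>)"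
  define A where "A = (1 - \<rho>) * c1 / B"
  have B: "0 < B" and A: "0 < A" using pos by (simp_all add: B_def A_def)
  have "a * ((1 - \<rho>) * (c1 * s\<^sup>2)) \<le> a * ((1 - \<rho>) * (- q))"
    using q pos by (intro mult_left_mono) auto
  also have "\<dots> \<le> a * (H * a powr \<theta> * D powr (1 + \<theta>))"
    using upper reject \<open>0 \<le> \<nu>\<close> pos by (simp add: powr_add algebra_simps)
  also have "\<dots> \<le> a * (H * a powr \<theta> * (c2 * s) powr (1 + \<theta>))"
    using D pos by (intro mult_left_mono powr_mono2) auto
  also have "\<dots> = a * (B * a powr \<theta> * s powr (1 + \<theta>))"
    using pos by (simp add: B_def powr_mult)
  finally have "(1 - \<rho>) * (c1 * s\<^sup>2) \<le> B * a powr \<theta> * s powr (1 + \<theta>)"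
    using pos by simp
  \<comment> \<open>Both sides then carry the factor \<open>s powr (1 + \<theta>)\<close>, which
    cancels and leaves a lower bound for \<open>a powr \<theta>\<close>.\<close>
  moreover have "s\<^sup>2 = s powr (1 - \<theta>) * s powr (1 + \<theta>)"
    using pos by (simp flip: powr_add)
  ultimately have "((1 - \<rho>) * c1 * s powr (1 - \<theta>)) * s powr (1 + \<theta>) \<le> (B * a powr \<theta>) * s powr (1 + \<theta>)"
    by (simp add: mult_ac)
  then have "(1 - \<rho>) * c1 * s powr (1 - \<theta>) \<le> B * a powr \<theta>"
    using pos by simp
  then have "A * s powr (1 - \<theta>) \<le> a powr \<theta>"
    using B by (simp add: A_def field_simps)
  then have "(A * s powr (1 - \<theta>)) powr (1 / \<theta>) \<le> (a powr \<theta>) powr (1 / \<theta>)"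
    using A pos by (intro powr_mono2) auto
  then have "A powr (1 / \<theta>) * s powr ((1 - \<theta>) / \<theta>) \<le> a"
    using A pos by (simp add: powr_mult powr_powr)
  \<comment> \<open>The guaranteed decrease is proportional to \<open>a * s\<^sup>2\<close>, not to
    \<open>a\<close>, so the bound on \<open>a\<close> is multiplied by
    \<open>s\<^sup>2\<close>.\<close>
  then have "A powr (1 / \<theta>) * s powr ((1 - \<theta>) / \<theta>) * s\<^sup>2 \<le> a * s\<^sup>2"
    by (rule mult_right_mono) simp
  moreover have "s powr ((1 - \<theta>) / \<theta>) * s\<^sup>2 = s powr (1 + 1 / \<theta>)"
  proof -
    have "(1 - \<theta>) / \<theta> + 2 = 1 + 1 / \<theta>" using pos by (simp add: field_simps)
    moreover have "s\<^sup>2 = s powr 2" using pos by simp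
    ultimately show ?thesis by (simp only: powr_add[symmetric])
  qed
  ultimately show ?thesis by (simp add: A_def B_def mult.assoc)
qed

section \<open>Absorbing the Metropolis allowances\<close>

text \<open>For \<gamma> \<le> 1 the sum can grow without bound in \<open>T\<close>, so no constant
  bounds it. Terms of size at most \<open>a / 2\<close> are instead charged to the left-hand side,
  where they use up at most half of \<open>real T * a\<close>; each of the few remaining terms is at
  most \<sigma>.\<close>

lemma sum_powr_absorb:
  fixes a b \<sigma> \<gamma> :: real
  assumes "0 < a" "0 \<le> \<sigma>" "0 < \<gamma>"
    and le: "real T * a \<le> b + (\<Sum>k<T. \<sigma> * (real k + 1) powr (- \<gamma>))"
  shows "real T * a \<le> 2 * (b + \<sigma> * (2 * \<sigma> / a) powr (1 / \<gamma>))"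
proof -
  \<comment> \<open>The threshold at which \<sigma> > 0 gives
    \<open>\<sigma> * K powr (- \<gamma>) = a / 2\<close>. For \<sigma> = 0 it is 0, and no index is
    exceptional.\<close>
  define K where "K = (2 * \<sigma> / a) powr (1 / \<gamma>)"
  have K: "0 \<le> K" "K powr \<gamma> = 2 * \<sigma> / a"
    using assms by (simp_all add: K_def powr_powr)
  have split: "\<sigma> * (real k + 1) powr (- \<gamma>) \<le> a / 2 + (if real k + 1 \<le> K then \<sigma> else 0)" for k
  proof (cases "real k + 1 \<le> K")
    case True
    have "(real k + 1) powr (- \<gamma>) \<le> 1"
      using \<open>0 < \<gamma>\<close> powr_mono[of "- \<gamma>" 0 "real k + 1"] by simp
    then have "\<sigma> * (real k + 1) powr (- \<gamma>) \<le> \<sigma> * 1"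
      using \<open>0 \<le> \<sigma>\<close> by (intro mult_left_mono)
    then show ?thesis using True \<open>0 < a\<close> by simp
  next
    case False
    then have "2 * \<sigma> / a \<le> (real k + 1) powr \<gamma>"
      using K \<open>0 < \<gamma>\<close> powr_mono2[of \<gamma> K "real k + 1"] by simp
    then show ?thesis
      using False \<open>0 < a\<close> by (simp add: powr_minus field_simps)
  qed
  \<comment> \<open>Since k starts at 0, the condition \<open>real k + 1 \<le> K\<close> leaves at
    most the floor of \<open>K\<close> many indices, with no extra 1.\<close>
  have "card {k. k < T \<and> real k + 1 \<le> K} \<le> card {..<nat \<lfloor>K\<rfloor>}"
  proof (intro card_mono subsetI)
    fix k assume "k \<in> {k. k < T \<and> real k + 1 \<le> K}"
    then have "int (Suc k) \<le> \<lfloor>K\<rfloor>" by (simp add: le_floor_iff add.commute)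
    then show "k \<in> {..<nat \<lfloor>K\<rfloor>}" by simp
  qed simp
  then have card: "real (card {k. k < T \<and> real k + 1 \<le> K}) \<le> K"
    using K(1) of_nat_floor[of K] by simp linarith
  have "(\<Sum>k<T. \<sigma> * (real k + 1) powr (- \<gamma>)) \<le>
      (\<Sum>k<T. a / 2 + (if real k + 1 \<le> K then \<sigma> else 0))"
    by (intro sum_mono split)
  also have "\<dots> = real T * a / 2 + \<sigma> * real (card {k. k < T \<and> real k + 1 \<le> K})"
  proof -
    have "{..<T} \<inter> {k. real k + 1 \<le> K} = {k. k < T \<and> real k + 1 \<le> K}" by auto
    then show ?thesis by (simp add: sum.distrib sum.If_cases)
  qed
  also have "\<dots> \<le> real T * a / 2 + \<sigma> * K"
    using card \<open>0 \<le> \<sigma>\<close> by (intro add_left_mono mult_left_mono)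
  finally show ?thesis using le by (simp add: K_def)
qed

text \<open>The maximum with \<gamma> bounds the exponent whatever the function values are, and
  dividing by the temperature multiplies by \<open>ln (real k + 1) \<ge> 0\<close>. At k = 0
  division by zero makes the exponent 0, so both sides equal \<open>\<sigma> i\<close>.\<close>

lemma metropolis_term_log_temperature_le:
  assumes "0 \<le> \<sigma> i"
  shows "metropolis_term f \<sigma> \<gamma> (log_temperature k) y z i \<le> \<sigma> i * (real k + 1) powr (- \<gamma>)"
proof -
  have "- (max \<gamma> (f i z - f i y) * ln (real k + 1)) \<le> - (\<gamma> * ln (real k + 1))"
    by (simp add: mult_right_mono)
  then have "exp (- (max \<gamma> (f i z - f i y) * ln (real k + 1))) \<le> (real k + 1) powr (- \<gamma>)"
    by (simp add: powr_def)
  then show ?thesis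
    using assms by (simp add: metropolis_term_def log_temperature_def mult_left_mono)
qed

theorem mainTheorem6:
  fixes m :: nat
    and c1 c2 \<beta> \<rho> \<gamma> :: real
    and \<sigma> \<theta> H \<delta> :: "nat \<Rightarrow> real"
  assumes "1 \<le> m"
    and "0 < \<beta>" "\<beta> < 1" "0 < \<rho>" "\<rho> < 1" "0 < c1" "0 < c2" "0 < \<gamma>"
    and "\<forall>i\<in>{1..m}. 0 \<le> \<sigma> i"
    and "\<forall>i\<in>{1..m}. 0 < \<theta> i \<and> \<theta> i \<le> 1"
    and "\<forall>i\<in>{1..m}. 0 < H i"
  shows "\<exists>C>0. \<forall>(n::nat) (\<Omega>::finseq set) (f::nat \<Rightarrow> finseq \<Rightarrow> real) (g::nat \<Rightarrow> finseq \<Rightarrow> finseq)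
            (fstar::nat \<Rightarrow> real) (x::nat \<Rightarrow> finseq) (d::nat \<Rightarrow> finseq) (ls::nat \<Rightarrow> nat).
      1 \<le> n \<longrightarrow> \<Omega> \<subseteq> Rn n \<longrightarrow> \<Omega> \<noteq> {} \<longrightarrow> closed \<Omega> \<longrightarrow> convex \<Omega> \<longrightarrow>
      (\<forall>i\<in>{1..m}. cont_diff_with_gradient n (f i) (g i)) \<longrightarrow>
      (\<forall>i\<in>{1..m}. \<forall>y\<in>\<Omega>. \<forall>z\<in>\<Omega>. norm (g i y - g i z) \<le> H i * norm (z - y) powr \<theta> i) \<longrightarrow>
      (\<forall>i\<in>{1..m}. \<forall>y\<in>\<Omega>. fstar i \<le> f i y) \<longrightarrow>
      (\<forall>i\<in>{1..m}. f i (x 0) - fstar i = \<delta> i) \<longrightarrow>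
      metropolis_method m f g \<Omega> c1 c2 \<beta> \<rho> \<sigma> \<gamma> log_temperature x d ls \<longrightarrow>
      (\<forall>\<epsilon> T. 0 < \<epsilon> \<longrightarrow> \<epsilon> < 1 \<longrightarrow> (\<forall>k<T. \<epsilon> < norm (steepest_dir m g \<Omega> (x k))) \<longrightarrow>
         real T \<le> C * \<epsilon> powr (- ((1 + 1 / Min (\<theta> ` {1..m})) * (1 + 1 / \<gamma>))))"
proof -

  \<comment> \<open>Constants that depend only on the data fixed in advance\<close>
  define p where "p = 1 + 1 / Min (\<theta> ` {1..m})"
  \<comment> \<open>The factor \<beta> passes from the last rejected step to the accepted
    one.\<close>
  define \<kappa>' where "\<kappa>' i = \<beta> * ((1 - \<rho>) * c1 / (H i * c2 powr (1 + \<theta> i))) powr (1 / \<theta> i)" for i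
  \<comment> \<open>The minimum runs over all objectives because any of them may cause a rejection;
    the inserted 1 covers iterations without backtracking.\<close>
  define \<kappa> where "\<kappa> = Min (insert 1 (\<kappa>' ` {1..m}))"
  define a0 where "a0 = \<rho> * c1 * \<kappa>"
  \<comment> \<open>This is the bound of \<open>sum_powr_absorb\<close> with the powers of
    \<epsilon> removed, divided by \<open>a0\<close>. The absolute value is taken because
    \<open>\<delta> 1\<close> has no assumed sign here; the final 1 keeps \<open>C\<close> positive
    even if \<open>\<delta> 1\<close> and \<open>\<sigma> 1\<close> vanish.\<close>
  define C where "C = 2 / a0 * (\<bar>\<delta> 1\<bar> + \<sigma> 1 * (2 * \<sigma> 1 / a0) powr (1 / \<gamma>)) + 1"
  have one: "1 \<in> {1..m}" using assms(1) by simp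
  have \<sigma>: "0 \<le> \<sigma> i" and \<theta>: "0 < \<theta> i" "\<theta> i \<le> 1" and H: "0 < H i" if "i \<in> {1..m}" for i
    using assms(9-11) that by auto
  have "Min (\<theta> ` {1..m}) \<in> \<theta> ` {1..m}"
    using one by (intro Min_in) auto
  then have \<theta>min: "0 < Min (\<theta> ` {1..m})" "Min (\<theta> ` {1..m}) \<le> 1"
    using \<theta> by auto
  have p: "1 + 1 / \<theta> i \<le> p" if "i \<in> {1..m}" for i
    using \<theta>min that \<theta>[OF that] by (auto simp: p_def intro!: divide_left_mono)
  \<comment> \<open>Hence \<open>\<epsilon> powr p \<le> \<epsilon> powr 2\<close> for \<epsilon> <
    1, which handles full steps.\<close>
  have p2: "2 \<le> p" using \<theta>min by (simp add: p_def)
  have \<kappa>le: "\<kappa> \<le> 1" "\<And>i. i \<in> {1..m} \<Longrightarrow> \<kappa> \<le> \<kappa>' i"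
    unfolding \<kappa>_def by (intro Min_le; simp)+
  have "0 < \<kappa>' i" if "i \<in> {1..m}" for i
    using assms(2-7) H[OF that] by (simp add: \<kappa>'_def)
  then have \<kappa>pos: "0 < \<kappa>"
    by (simp add: \<kappa>_def)
  then have a0: "0 < a0" using assms(2-7) by (simp add: a0_def)
  have "0 < C" using a0 \<sigma>[OF one] by (simp add: C_def add_nonneg_pos)
  moreover have "real T \<le> C * \<epsilon> powr (- (p * (1 + 1 / \<gamma>)))"
    if \<Omega>: "\<Omega> \<subseteq> Rn n" "convex \<Omega>"
      and grad: "\<forall>i\<in>{1..m}. cont_diff_with_gradient n (f i) (g i)"
      and holder: "\<forall>i\<in>{1..m}. \<forall>y\<in>\<Omega>. \<forall>z\<in>\<Omega>. norm (g i y - g i z) \<le> H i * norm (z - y) powr \<theta> i"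
      and below: "\<forall>i\<in>{1..m}. \<forall>y\<in>\<Omega>. fstar i \<le> f i y"
      and gap: "\<forall>i\<in>{1..m}. f i (x 0) - fstar i = \<delta> i"
      and run: "metropolis_method m f g \<Omega> c1 c2 \<beta> \<rho> \<sigma> \<gamma> log_temperature x d ls"
      and \<epsilon>: "0 < \<epsilon>" "\<epsilon> < 1"
      and large: "\<forall>k<T. \<epsilon> < norm (steepest_dir m g \<Omega> (x k))"
    for n \<Omega> f g fstar x d ls \<epsilon> T
  proof -
    define s where "s k = norm (steepest_dir m g \<Omega> (x k))" for k
    have x0: "x 0 \<in> \<Omega>" using run by (simp add: metropolis_method_def)
    have dmem: "x k + d k \<in> \<Omega>"
      and slope: "max_slope m g (x k) (d k) \<le> - c1 * (s k)\<^sup>2"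
      and dle: "norm (d k) \<le> c2 * s k"
      and acc: "accepted m f g \<beta> \<rho> \<sigma> \<gamma> (log_temperature k) (x k) (d k) (ls k)"
      and rej: "\<And>l. l < ls k \<Longrightarrow> \<not> accepted m f g \<beta> \<rho> \<sigma> \<gamma> (log_temperature k) (x k) (d k) l"
      and step: "x (Suc k) = x k + \<beta> ^ ls k *\<^sub>R d k" for k
      using run by (auto simp: metropolis_method_def translate_to_def s_def add.commute)
    have pow: "0 < \<beta> ^ l" "\<beta> ^ l \<le> 1" for l
      using assms(2,3) by (simp_all add: power_le_one)
    have xmem: "x k \<in> \<Omega>" for k
    proof (induction k)
      case (Suc k)
      then show ?case
        unfolding step using convex_add_scaleR_mem[OF \<Omega>(2) Suc dmem] pow[of "ls k"] by simp
    qed (rule x0)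
    have q: "g i (x k) \<bullet> d k \<le> - c1 * (s k)\<^sup>2" if "i \<in> {1..m}" for i k
    proof -
      have "g i (x k) \<bullet> d k \<le> max_slope m g (x k) (d k)"
        unfolding max_slope_def using that by (intro Max_ge) auto
      then show ?thesis using slope[of k] by linarith
    qed

    \<comment> \<open>Uniform lower bound on step length times squared criticality measure\<close>
    have decrease: "\<kappa> * \<epsilon> powr p \<le> \<beta> ^ ls k * (s k)\<^sup>2" if "k < T" for k
    proof -
      have sk: "\<epsilon> < s k" using large that by (simp add: s_def)
      show ?thesis
      proof (cases "ls k")
        case 0
        have "\<kappa> * \<epsilon> powr p \<le> 1 * \<epsilon> powr 2"
          using \<kappa>le \<kappa>pos p2 \<epsilon> by (intro mult_mono powr_mono') auto
        also have "\<dots> \<le> (s k)\<^sup>2"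
          using sk \<epsilon> by (simp add: power_mono)
        finally show ?thesis using 0 by simp
      next
        case (Suc l)
        \<comment> \<open>Minimality of \<open>ls k\<close> makes the preceding trial
          \<open>l\<close> fail, for an objective that may vary with \<open>k\<close>.\<close>
        then obtain i where i: "i \<in> {1..m}"
          and fail: "f i (x k) + \<rho> * \<beta> ^ l * (g i (x k) \<bullet> d k)
            + metropolis_term f \<sigma> \<gamma> (log_temperature k) (x k) (x k + \<beta> ^ l *\<^sub>R d k) i
            < f i (x k + \<beta> ^ l *\<^sub>R d k)"
          using rej[of l k] by (auto simp: accepted_def not_le)
        have "(f i has_derivative (\<lambda>h. g i y \<bullet> h)) (at y within \<Omega>)" if "y \<in> \<Omega>" for y
          using grad i that \<Omega>(1) unfolding cont_diff_with_gradient_def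
          by (blast intro: has_derivative_subset)
        then have up: "f i (x k + \<beta> ^ l *\<^sub>R d k) \<le> f i (x k) + \<beta> ^ l * (g i (x k) \<bullet> d k)
            + H i * (\<beta> ^ l) powr (1 + \<theta> i) * norm (d k) powr (1 + \<theta> i)"
          using holder i H[OF i] \<theta>[OF i] pow[of l]
          by (intro holder_gradient_upper_bound[OF \<Omega>(2) xmem dmem]) auto
        have "((1 - \<rho>) * c1 / (H i * c2 powr (1 + \<theta> i))) powr (1 / \<theta> i) * s k powr (1 + 1 / \<theta> i)
            \<le> \<beta> ^ l * (s k)\<^sup>2"
          by (rule rejected_step_lower_bound[OF up fail _ q[OF i] _ dle])
            (use sk \<epsilon> assms(4-7) pow \<sigma>[OF i] H[OF i] \<theta>[OF i] in \<open>auto simp: metropolis_term_def\<close>)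
        then have long: "\<kappa>' i * s k powr (1 + 1 / \<theta> i) \<le> \<beta> ^ ls k * (s k)\<^sup>2"
          using assms(2) by (simp add: \<kappa>'_def Suc mult.assoc)
        \<comment> \<open>As \<epsilon> < 1, the largest exponent \<open>p\<close> gives the
          smallest power, valid for every \<open>i\<close>.\<close>
        have "\<epsilon> powr p \<le> \<epsilon> powr (1 + 1 / \<theta> i)"
          using p[OF i] \<epsilon> by (intro powr_mono') auto
        also have "\<dots> \<le> s k powr (1 + 1 / \<theta> i)"
          using sk \<epsilon> \<theta>[OF i] by (intro powr_mono2) auto
        finally have "\<kappa> * \<epsilon> powr p \<le> \<kappa>' i * s k powr (1 + 1 / \<theta> i)"
          using \<kappa>le(2)[OF i] \<kappa>pos by (intro mult_mono) auto
        then show ?thesis using long by simp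
      qed
    qed

    \<comment> \<open>Telescoping and extraction of the rate\<close>
    define a where "a = a0 * \<epsilon> powr p"
    have a: "0 < a" using a0 \<epsilon> by (simp add: a_def)
    \<comment> \<open>One objective is enough: the test is passed by all of them, and
      \<open>max_slope\<close> bounds each slope. Index 1 exists because
      \<open>1 \<le> m\<close>.\<close>
    have one_step: "f 1 (x (Suc k)) \<le> f 1 (x k) - a + \<sigma> 1 * (real k + 1) powr (- \<gamma>)"
      if "k < T" for k
    proof -
      have "f 1 (x (Suc k)) \<le> f 1 (x k) + \<rho> * \<beta> ^ ls k * (g 1 (x k) \<bullet> d k)
          + metropolis_term f \<sigma> \<gamma> (log_temperature k) (x k) (x (Suc k)) 1"
        using acc[of k] one by (auto simp: accepted_def step)
      moreover have "\<rho> * \<beta> ^ ls k * (g 1 (x k) \<bullet> d k) \<le> \<rho> * \<beta> ^ ls k * (- c1 * (s k)\<^sup>2)"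
        using assms(4) pow(1)[of "ls k"] q[OF one]
        by (intro mult_left_mono mult_nonneg_nonneg) auto
      moreover have "\<rho> * c1 * (\<kappa> * \<epsilon> powr p) \<le> \<rho> * c1 * (\<beta> ^ ls k * (s k)\<^sup>2)"
        using assms(4,6) decrease[OF that] by (intro mult_left_mono) auto
      ultimately show ?thesis
        using metropolis_term_log_temperature_le[where \<sigma> = \<sigma> and i = 1, OF \<sigma>[OF one],
            of f \<gamma> k "x k" "x (Suc k)"]
        by (simp add: a_def a0_def mult_ac)
    qed
    \<comment> \<open>The induction is limited to \<open>N \<le> T\<close>, as
      \<open>one_step\<close> needs a large criticality measure. The last iterate \<open>x T\<close>
      need not have one; it is only used as a point of \<Omega>, where \<open>fstar 1\<close> bounds
      \<open>f 1\<close> from below.\<close>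
    have "f 1 (x N) \<le> f 1 (x 0) - real N * a + (\<Sum>k<N. \<sigma> 1 * (real k + 1) powr (- \<gamma>))"
      if "N \<le> T" for N
      using that
    proof (induction N)
      case (Suc N)
      then show ?case using one_step[of N] by (simp add: algebra_simps)
    qed simp
    from this[of T]
    have "real T * a \<le> \<bar>\<delta> 1\<bar> + (\<Sum>k<T. \<sigma> 1 * (real k + 1) powr (- \<gamma>))"
      using below gap one xmem[of T] by fastforce
    then have "real T * a \<le> 2 * (\<bar>\<delta> 1\<bar> + \<sigma> 1 * (2 * \<sigma> 1 / a) powr (1 / \<gamma>))"
      by (rule sum_powr_absorb[OF a \<sigma>[OF one] assms(8)])
    moreover have "(2 * \<sigma> 1 / a) powr (1 / \<gamma>) = (2 * \<sigma> 1 / a0) powr (1 / \<gamma>) * \<epsilon> powr (- (p / \<gamma>))"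
    proof -
      have "2 * \<sigma> 1 / a = (2 * \<sigma> 1 / a0) * \<epsilon> powr (- p)"
        using a0 \<epsilon> by (simp add: a_def powr_minus field_simps)
      moreover have "0 \<le> 2 * \<sigma> 1 / a0" using a0 \<sigma>[OF one] by simp
      ultimately show ?thesis using \<epsilon> by (simp only: powr_mult powr_powr powr_ge_zero) simp
    qed
    \<comment> \<open>\<open>\<epsilon> powr (- (p / \<gamma>))\<close> is at least 1, so the
      initial gap can share this factor with the allowance term.\<close>
    moreover have "\<bar>\<delta> 1\<bar> * 1 \<le> \<bar>\<delta> 1\<bar> * \<epsilon> powr (- (p / \<gamma>))"
      using \<epsilon> p2 assms(8) powr_mono'[of "- (p / \<gamma>)" 0 \<epsilon>] by (intro mult_left_mono) auto
    ultimately have "real T * a \<le>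
        2 * (\<bar>\<delta> 1\<bar> + \<sigma> 1 * (2 * \<sigma> 1 / a0) powr (1 / \<gamma>)) * \<epsilon> powr (- (p / \<gamma>))"
      by (simp add: algebra_simps)
    also have "\<dots> = a0 * (C - 1) * \<epsilon> powr (- (p / \<gamma>))"
      using a0 by (simp add: C_def)
    also have "\<dots> \<le> a0 * C * \<epsilon> powr (- (p / \<gamma>))"
      using a0 by (intro mult_right_mono) auto
    \<comment> \<open>Splitting off \<open>\<epsilon> powr p\<close> restores the factor
      \<open>a\<close>, which then cancels from both sides.\<close>
    also have "\<dots> = C * \<epsilon> powr (- (p * (1 + 1 / \<gamma>))) * a"
    proof -
      have "- (p * (1 + 1 / \<gamma>)) + p = - (p / \<gamma>)" by (simp add: algebra_simps)
      then have "\<epsilon> powr (- (p * (1 + 1 / \<gamma>))) * \<epsilon> powr p = \<epsilon> powr (- (p / \<gamma>))"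
        by (simp only: powr_add[symmetric])
      then show ?thesis by (simp add: a_def mult_ac)
    qed
    finally show ?thesis using a by simp
  qed
  ultimately show ?thesis
    unfolding p_def by (intro exI[of _ C]) blast
qed

end
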